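(* Let $b>3$ be an integer coprime to $3$, let $f=2b-3$, and let $k$ be the unique integer closest to $b/3$. Let $r_1\ge r_2\ge\dots\ge r_k\ge 0$ be fixed integers. If $b=3k+1$, then $$\sum_{\mathbf{n}}\left(\prod_{j=1}^{k}\binom{n_{3j+2}}{n_{3j-1}}\right)\prod_{j=1}^{k}\binom{r_{k-j+1}-n_{3j-5}}{n_{3j-2}-n_{3j-5}}=\sum_{m_1,\dots,m_k}\binom{2r_k}{m_k}\prod_{i=1}^{k-1}\binom{r_i-r_{i+1}+m_{i+1}}{m_i}.$$ If $b=3k-1$, then $$\sum_{\mathbf{n}}\left(\prod_{j=1}^{k-1}\binom{n_{3j+1}}{n_{3j-2}}\right)\prod_{j=1}^{k-1}\binom{r_{k-j}-n_{3j-4}}{n_{3j-1}-n_{3j-4}}=\sum_{m_1,\dots,m_{k-1}}\binom{r_{k-1}+r_k}{m_{k-1}}\prod_{i=1}^{k-2}\binom{r_i-r_{i+1}+m_{i+1}}{m_i}.$$ In both cases the sum on the left is over all $\mathbf{n}=(n_i)_{i\in G}\in\mathbb{Z}^G$ subject to $n_{f+3-3j}=r_j$ for $j=1,\dots,k$, with the convention $n_i=0$ for $i<0$, and the sum on the right is over all integers $m_i$.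
   Context: $\Gamma=\langle 3,b\rangle=\{3x+by:x,y\in\mathbb{Z}_{\ge0}\}$ and $G=\mathbb{Z}_{\ge0}\setminus\Gamma$ is its finite set of gaps, whose maximum is $f=2b-3$. The binomial coefficient $\binom{N}{M}$ is $\frac{N!}{M!(N-M)!}$ if $0\le M\le N$, and $0$ otherwise (in particular $0$ if $N<0$). With this convention all sums have only finitely many nonzero terms. Empty products equal $1$. *)

theory Defs
  imports "HOL-Analysis.Infinite_Sum"
begin

definition Gam :: "int \<Rightarrow> int set"
  where "Gam b = {3 * x + b * y | x y. x \<ge> 0 \<and> y \<ge> 0}"

definition gaps :: "int \<Rightarrow> int set"
  where "gaps b = {0..} - Gam b"

text \<open>
  The library's \<open>choose\<close> takes natural number arguments; the guard gives the value 0
  whenever an argument is negative.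
\<close>

definition binom :: "int \<Rightarrow> int \<Rightarrow> int"
  where "binom N M = (if 0 \<le> M \<and> M \<le> N then int (nat N choose nat M) else 0)"

text \<open>
  The tuples \<open>(n\<^sub>i)\<close> of integers indexed by \<open>i \<in> I\<close>, represented by their extension by zero.
  For \<open>I = gaps b\<close> this representation contains the convention that \<open>n\<^sub>i = 0\<close> for \<open>i < 0\<close>.
\<close>

definition tuples :: "int set \<Rightarrow> (int \<Rightarrow> int) set"
  where "tuples I = {n. \<forall>i. i \<notin> I \<longrightarrow> n i = 0}"

text \<open>
  Sums over infinitely many tuples are written with \<^const>\<open>infsum\<close>, which is 0 for a family
  that is not summable. The lemmas \<open>finite_support\<close> below show that all the families in
  question have finite support, so that this default value is never used.
\<close>

lemma binom_nonzero_iff: "binom N M \<noteq> 0 \<longleftrightarrow> 0 \<le> M \<and> M \<le> N"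
  by (auto simp: binom_def nat_le_iff)

lemma finite_bounded_tuples:
  assumes "finite I" and "A \<subseteq> tuples I" and "\<And>n i. n \<in> A \<Longrightarrow> i \<in> I \<Longrightarrow> n i \<in> {0..R}"
  shows "finite A"
proof (rule finite_subset)
  show "A \<subseteq> {n. \<forall>i. (i \<in> I \<longrightarrow> n i \<in> {0..R}) \<and> (i \<notin> I \<longrightarrow> n i = 0)}"
    using assms(2,3) by (auto simp: tuples_def)
  show "finite {n. \<forall>i. (i \<in> I \<longrightarrow> n i \<in> {0..R}) \<and> (i \<notin> I \<longrightarrow> n i = 0)}"
    using assms(1) by (intro finite_set_of_finite_funs) auto
qed

lemma gaps_1:
  assumes "b = 3 * k + 1" and "i \<in> gaps b"
  shows "(\<exists>j\<in>{1..k}. i = 3 * j - 2) \<or> (\<exists>j\<in>{1..2*k}. i = 3 * j - 1)"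
proof -
  have i: "0 \<le> i" and ni: "\<And>x y. i = 3 * x + b * y \<Longrightarrow> 0 \<le> x \<Longrightarrow> 0 \<le> y \<Longrightarrow> False"
    using assms(2) by (auto simp: gaps_def Gam_def)
  define q where "q = i div 3"
  have q: "0 \<le> q" using i by (simp add: q_def)
  have q_cases: "i = 3 * q \<or> i = 3 * q + 1 \<or> i = 3 * q + 2" unfolding q_def by presburger
  consider "i = 3 * q" | "i = 3 * q + 1" | "i = 3 * q + 2" using q_cases by blast
  then show ?thesis
  proof cases
    case 1 then show ?thesis using ni[of q 0] q by simp
  next
    case 2
    then have "q < k" using ni[of "q - k" 1] assms(1) by (force simp: not_less)
    then show ?thesis using 2 q by (intro disjI1 bexI[of _ "q + 1"]) auto
  next
    case 3
    then have "q < 2 * k" using ni[of "q - 2 * k" 2] assms(1) by (force simp: not_less)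
    then show ?thesis using 3 q by (intro disjI2 bexI[of _ "q + 1"]) auto
  qed
qed

lemma gaps_2:
  assumes "b = 3 * k - 1" and "i \<in> gaps b"
  shows "(\<exists>j\<in>{1..2*k-1}. i = 3 * j - 2) \<or> (\<exists>j\<in>{1..k-1}. i = 3 * j - 1)"
proof -
  have i: "0 \<le> i" and ni: "\<And>x y. i = 3 * x + b * y \<Longrightarrow> 0 \<le> x \<Longrightarrow> 0 \<le> y \<Longrightarrow> False"
    using assms(2) by (auto simp: gaps_def Gam_def)
  define q where "q = i div 3"
  have q: "0 \<le> q" using i by (simp add: q_def)
  have q_cases: "i = 3 * q \<or> i = 3 * q + 1 \<or> i = 3 * q + 2" unfolding q_def by presburger
  consider "i = 3 * q" | "i = 3 * q + 1" | "i = 3 * q + 2" using q_cases by blast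
  then show ?thesis
  proof cases
    case 1 then show ?thesis using ni[of q 0] q by simp
  next
    case 2
    then have "q < 2 * k - 1" using ni[of "q - (2 * k - 1)" 2] assms(1) by (force simp: not_less)
    then show ?thesis using 2 q by (intro disjI1 bexI[of _ "q + 1"]) auto
  next
    case 3
    then have "q < k - 1" using ni[of "q - (k - 1)" 1] assms(1) by (force simp: not_less)
    then show ?thesis using 3 q by (intro disjI2 bexI[of _ "q + 1"]) auto
  qed
qed

lemma finite_gaps:
  assumes "coprime b 3" and "b > 3"
  shows "finite (gaps b)"
proof -
  have "b mod 3 \<noteq> 0"
  proof
    assume "b mod 3 = 0"
    then have "3 dvd b" by presburger
    then have "is_unit (3::int)" using assms(1) by (meson coprime_common_divisor dvd_refl)
    then show False by simp
  qed
  then consider k where "b = 3 * k + 1" | k where "b = 3 * k - 1"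
  proof -
    have "b = 3 * (b div 3) + 1 \<or> b = 3 * (b div 3 + 1) - 1"
      using \<open>b mod 3 \<noteq> 0\<close> by presburger
    then show thesis using that by blast
  qed
  then show ?thesis
  proof cases
    case 1
    then have "gaps b \<subseteq> (\<lambda>j. 3 * j - 2) ` {1..k} \<union> (\<lambda>j. 3 * j - 1) ` {1..2*k}"
      using gaps_1 by blast
    then show ?thesis by (rule finite_subset) auto
  next
    case 2
    then have "gaps b \<subseteq> (\<lambda>j. 3 * j - 2) ` {1..2*k-1} \<union> (\<lambda>j. 3 * j - 1) ` {1..k-1}"
      using gaps_2 by blast
    then show ?thesis by (rule finite_subset) auto
  qed
qed

lemma antimono_seq:
  fixes r :: "int \<Rightarrow> int"
  assumes "\<And>j. 1 \<le> j \<Longrightarrow> j < k \<Longrightarrow> r (j + 1) \<le> r j" and "1 \<le> i" "i \<le> j" "j \<le> k"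
  shows "r j \<le> r i"
  using assms(3,4)
proof (induction j rule: int_ge_induct)
  case (step j)
  then show ?case using assms(1)[of j] assms(2) by simp
qed simp

lemma chain_bound:
  fixes a :: "int \<Rightarrow> int"
  assumes "\<And>j. 1 \<le> j \<Longrightarrow> j \<le> K \<Longrightarrow> 0 \<le> a j \<and> a j \<le> a (j + 1)"
    and "a (K + 1) \<le> R" and "1 \<le> j" "j \<le> K"
  shows "a j \<in> {0..R}"
proof -
  have "1 \<le> j \<longrightarrow> a j \<le> R" if "j \<le> K + 1" for j
    using that
  proof (induction j rule: int_le_induct)
    case base
    then show ?case using assms(2) by simp
  next
    case (step j)
    then show ?case using assms(1)[of "j - 1"] by auto
  qed
  then show ?thesis using assms(1)[of j] assms(3,4) by auto
qed

lemma chain_bound':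
  fixes c s :: "int \<Rightarrow> int"
  assumes step: "\<And>j. 1 \<le> j \<Longrightarrow> j \<le> K \<Longrightarrow> 0 \<le> c j - c (j - 1) \<and> c j - c (j - 1) \<le> s j - c (j - 1)"
    and "c 0 = 0" and s: "\<And>j. 1 \<le> j \<Longrightarrow> j \<le> K \<Longrightarrow> s j \<le> R" and j: "1 \<le> j" "j \<le> K"
  shows "c j \<in> {0..R}"
proof -
  have "j \<le> K \<longrightarrow> 0 \<le> c j" if "0 \<le> j" for j
    using that
  proof (induction j rule: int_ge_induct)
    case base
    then show ?case using assms(2) by simp
  next
    case (step j)
    then show ?case using assms(1)[of "j + 1"] by auto
  qed
  then show ?thesis using step[of j] s[of j] j by force
qed

lemma finite_support_right:
  fixes r :: "int \<Rightarrow> int"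
  shows "finite {m \<in> tuples {1..K}. binom N (m K) *
    (\<Prod>i=1..K-1. binom (r i - r (i + 1) + m (i + 1)) (m i)) \<noteq> 0}" (is "finite ?A")
proof (cases "K \<ge> 1")
  case True
  have bd: "0 \<le> m i \<and> m i \<le> N + (r i - r K)" if m: "m \<in> ?A" and "i \<in> {1..K}" for m i
  proof -
    have mK: "0 \<le> m K" "m K \<le> N" using m by (auto simp: binom_nonzero_iff)
    have mi: "0 \<le> m i \<and> m i \<le> r i - r (i + 1) + m (i + 1)" if "i \<in> {1..K-1}" for i
      using m that by (auto simp: binom_nonzero_iff)
    have "1 \<le> i \<longrightarrow> 0 \<le> m i \<and> m i \<le> N + (r i - r K)" if "i \<le> K" for i
      using that
    proof (induction i rule: int_le_induct)
      case base
      then show ?case using mK by simp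
    next
      case (step i)
      then show ?case using mi[of "i - 1"] by auto
    qed
    then show ?thesis using that by auto
  qed
  define R where "R = Max ((\<lambda>i. N + (r i - r K)) ` {1..K})"
  have R: "N + (r i - r K) \<le> R" if "i \<in> {1..K}" for i
    unfolding R_def using that by (intro Max_ge) auto
  show ?thesis
  proof (rule finite_bounded_tuples[of "{1..K}" _ R])
    fix m i assume "m \<in> ?A" "i \<in> {1..K}"
    then show "m i \<in> {0..R}" using bd[of m i] R[of i] by force
  qed auto
next
  case False
  then have "tuples {1..K} \<subseteq> {\<lambda>_. 0}" by (auto simp: tuples_def)
  then have "?A \<subseteq> {\<lambda>_. 0}" by auto
  then show ?thesis by (rule finite_subset) simp
qed

lemma finite_support_left_1:
  fixes r :: "int \<Rightarrow> int"
  assumes b: "b > 3" "coprime b 3" "b = 3 * k + 1"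
    and f: "f = 2 * b - 3"
    and r: "\<And>j. 1 \<le> j \<Longrightarrow> j < k \<Longrightarrow> r (j + 1) \<le> r j" "0 \<le> r k"
  shows "finite {n \<in> {n \<in> tuples (gaps b). \<forall>j\<in>{1..k}. n (f + 3 - 3 * j) = r j}.
     (\<Prod>j=1..k. binom (n (3 * j + 2)) (n (3 * j - 1))) *
     (\<Prod>j=1..k. binom (r (k - j + 1) - n (3 * j - 5)) (n (3 * j - 2) - n (3 * j - 5))) \<noteq> 0}"
  (is "finite ?A")
proof (rule finite_bounded_tuples[of "gaps b" _ "r 1"])
  show "finite (gaps b)" by (rule finite_gaps[OF b(2,1)])
  show "?A \<subseteq> tuples (gaps b)" by auto
  fix n i assume n: "n \<in> ?A" and i: "i \<in> gaps b"
  have k: "1 \<le> k" using b by simp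
  have r1: "r j \<le> r 1" "0 \<le> r j" if "1 \<le> j" "j \<le> k" for j
    using antimono_seq[of k r, OF r(1)] that r(2) by (auto intro: order_trans[of 0 "r k"])
  have fix_n: "n (6 * k + 2 - 3 * j) = r j" if "j \<in> {1..k}" for j
    using n that unfolding f b(3) by (auto simp: algebra_simps)
  have A: "0 \<le> n (3 * j - 1) \<and> n (3 * j - 1) \<le> n (3 * j + 2)" if "j \<in> {1..k}" for j
    using n that by (auto simp: binom_nonzero_iff)
  have C: "0 \<le> n (3 * j - 2) - n (3 * j - 5) \<and>
      n (3 * j - 2) - n (3 * j - 5) \<le> r (k - j + 1) - n (3 * j - 5)" if "j \<in> {1..k}" for j
    using n that by (simp add: binom_nonzero_iff)
  have n0: "n (-2) = 0" using n by (auto simp: tuples_def gaps_def)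
  have "n (3 * j - 1) \<in> {0..r 1}" if "j \<in> {1..2*k}" for j
  proof (cases "j \<le> k")
    case True
    show ?thesis
      using chain_bound[of k "\<lambda>j. n (3 * j - 1)" "r 1" j] A fix_n[of k] r1[of k] k that True
      by (simp add: algebra_simps)
  next
    case False
    then show ?thesis using fix_n[of "2 * k + 1 - j"] r1[of "2 * k + 1 - j"] that
      by (simp add: algebra_simps)
  qed
  moreover have "n (3 * j - 2) \<in> {0..r 1}" if "j \<in> {1..k}" for j
    using chain_bound'[of k "\<lambda>j. n (3 * j - 2)" "\<lambda>j. r (k - j + 1)" "r 1" j] C n0 r1 k that
    by (simp add: algebra_simps)
  ultimately show "n i \<in> {0..r 1}" using gaps_1[OF b(3) i] by blast
qed

lemma finite_support_left_2:
  fixes r :: "int \<Rightarrow> int"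
  assumes b: "b > 3" "coprime b 3" "b = 3 * k - 1"
    and f: "f = 2 * b - 3"
    and r: "\<And>j. 1 \<le> j \<Longrightarrow> j < k \<Longrightarrow> r (j + 1) \<le> r j" "0 \<le> r k"
  shows "finite {n \<in> {n \<in> tuples (gaps b). \<forall>j\<in>{1..k}. n (f + 3 - 3 * j) = r j}.
     (\<Prod>j=1..k-1. binom (n (3 * j + 1)) (n (3 * j - 2))) *
     (\<Prod>j=1..k-1. binom (r (k - j) - n (3 * j - 4)) (n (3 * j - 1) - n (3 * j - 4))) \<noteq> 0}"
  (is "finite ?A")
proof (rule finite_bounded_tuples[of "gaps b" _ "r 1"])
  show "finite (gaps b)" by (rule finite_gaps[OF b(2,1)])
  show "?A \<subseteq> tuples (gaps b)" by auto
  fix n i assume n: "n \<in> ?A" and i: "i \<in> gaps b"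
  have k: "2 \<le> k" using b by simp
  have r1: "r j \<le> r 1" "0 \<le> r j" if "1 \<le> j" "j \<le> k" for j
    using antimono_seq[of k r, OF r(1)] that r(2) by (auto intro: order_trans[of 0 "r k"])
  have fix_n: "n (6 * k - 2 - 3 * j) = r j" if "j \<in> {1..k}" for j
    using n that unfolding f b(3) by (auto simp: algebra_simps)
  have A: "0 \<le> n (3 * j - 2) \<and> n (3 * j - 2) \<le> n (3 * j + 1)" if "j \<in> {1..k-1}" for j
    using n that by (auto simp: binom_nonzero_iff)
  have C: "0 \<le> n (3 * j - 1) - n (3 * j - 4) \<and>
      n (3 * j - 1) - n (3 * j - 4) \<le> r (k - j) - n (3 * j - 4)" if "j \<in> {1..k-1}" for j
    using n that by (simp add: binom_nonzero_iff)
  have n0: "n (-1) = 0" using n by (auto simp: tuples_def gaps_def)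
  have "n (3 * j - 2) \<in> {0..r 1}" if "j \<in> {1..2*k-1}" for j
  proof (cases "j \<le> k - 1")
    case True
    show ?thesis
      using chain_bound[of "k - 1" "\<lambda>j. n (3 * j - 2)" "r 1" j] A fix_n[of k] r1[of k] k that True
      by (simp add: algebra_simps)
  next
    case False
    then show ?thesis using fix_n[of "2 * k - j"] r1[of "2 * k - j"] that
      by (simp add: algebra_simps)
  qed
  moreover have "n (3 * j - 1) \<in> {0..r 1}" if "j \<in> {1..k-1}" for j
    using chain_bound'[of "k - 1" "\<lambda>j. n (3 * j - 1)" "\<lambda>j. r (k - j)" "r 1" j] C n0 r1 k that
    by (simp add: algebra_simps)
  ultimately show "n i \<in> {0..r 1}" using gaps_2[OF b(3) i] by blast
qed

end

theory Submission
  imports Defs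
begin

text \<open>
  Write the gaps as two arithmetic progressions with difference \<open>3\<close>. If \<open>{p, q} = {1, 2}\<close>,
  \<open>b = 3 (K + 1) - q\<close> and \<open>2b = 3 (K + L + 1) - p\<close>, they are a long row \<open>3j - p\<close> with
  \<open>K + L\<close> elements and a short row \<open>3j - q\<close> with \<open>K\<close> elements (\<open>gaps_eq_two_rows\<close>). The constraints fix the last \<open>L\<close> entries of the long row to be
  \<open>r\<^sub>L, \<dots>, r\<^sub>1\<close>. So \<open>K\<close> entries remain free in each row, and each product on the left
  involves the free entries of one row only. The left side is a product of two sums.

  Both sums have the shape of the sum on the right. Let
  \[ S_K(r, N) = \sum_{m_1,\dots,m_K} {N \choose m_K}
     \prod_{i<K} {r_i - r_{i+1} + m_{i+1} \choose m_i}. \]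
  In the long row the sum is \<open>S\<^sub>K(0, r\<^sub>L)\<close>, with all differences \<open>r\<^sub>i - r\<^sub>i\<^sub>+\<^sub>1\<close> replaced by \<open>0\<close>. In
  the short row with entries \<open>c\<^sub>1, \<dots>, c\<^sub>K\<close>, read backwards and complemented to
  \<open>d\<^sub>i = r\<^sub>i - c\<^bsub>K+1-i\<^esub>\<close>, the symmetry of the binomial
  coefficients turns the sum into \<open>S\<^sub>K(r, r\<^sub>K)\<close> (\<open>row_weight_eq_chain_weights\<close>).

  Summing over \<open>m\<^sub>K\<close> last, the binomial theorem gives by induction
  \[ S_K(r, N) = (K+1)^N \prod_{i<K} (i+1)^{r_i - r_{i+1}} \]
  (\<open>chain_weight_has_sum\<close>). Since \<open>N\<close> enters only through \<open>(K+1)^N\<close>, the left side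
  \<open>S\<^sub>K(0, r\<^sub>L) S\<^sub>K(r, r\<^sub>K)\<close> equals \<open>S\<^sub>K(r, r\<^sub>K + r\<^sub>L)\<close>, the right side. The two
  cases are \<open>(p, q, K, L) = (1, 2, k, k)\<close> and \<open>(2, 1, k - 1, k)\<close>.
\<close>

section \<open>Sums of integer families with finite support\<close>

lemma has_sum_finite_support_iff:
  fixes f :: "'a \<Rightarrow> int"
  assumes "finite F" "F \<subseteq> A" "\<And>x. x \<in> A - F \<Longrightarrow> f x = 0"
  shows "(f has_sum s) A \<longleftrightarrow> s = sum f F"
proof -
  have "(f has_sum sum f F) A"
    using has_sum_finite[OF assms(1), of f] assms(2,3)
    by (subst has_sum_cong_neutral[where T = F and g = f]) auto
  then show ?thesis
    using infsumI by blast
qed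

text \<open>
  Finite support makes iterated summation purely combinatorial: both sides are sums over the
  finite rectangle spanned by the two projections of the support.
\<close>

lemma has_sum_iterated:
  fixes f :: "'a \<times> 'b \<Rightarrow> int"
  assumes fin: "finite {p \<in> A \<times> B. f p \<noteq> 0}"
    and inner: "\<And>a. a \<in> A \<Longrightarrow> ((\<lambda>b. f (a, b)) has_sum g a) B"
    and outer: "(g has_sum s) A"
  shows "(f has_sum s) (A \<times> B)"
proof -
  let ?A = "fst ` {p \<in> A \<times> B. f p \<noteq> 0}" and ?B = "snd ` {p \<in> A \<times> B. f p \<noteq> 0}"
  have sub: "?A \<subseteq> A" "?B \<subseteq> B" and finAB: "finite ?A" "finite ?B"
    using fin by auto
  have zero: "f (a, b) = 0" if "a \<in> A" "b \<in> B" "a \<notin> ?A \<or> b \<notin> ?B" for a b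
    using that by (force simp: image_iff)
  have g: "g a = (\<Sum>b\<in>?B. f (a, b))" if "a \<in> A" for a
    using inner[OF that] has_sum_finite_support_iff[OF finAB(2) sub(2), of "\<lambda>b. f (a, b)"]
      zero[OF that] by auto
  have "g a = 0" if "a \<in> A - ?A" for a
    using g[of a] zero[of a] sub(2) that by (auto intro!: sum.neutral)
  then have "s = sum g ?A"
    using outer has_sum_finite_support_iff[OF finAB(1) sub(1), of g] by blast
  also have "\<dots> = (\<Sum>a\<in>?A. \<Sum>b\<in>?B. f (a, b))"
    using sub g by (intro sum.cong) auto
  also have "\<dots> = sum f (?A \<times> ?B)"
    by (simp add: sum.cartesian_product)
  finally have "s = sum f (?A \<times> ?B)" .
  moreover have "(f has_sum s) (A \<times> B) \<longleftrightarrow> s = sum f (?A \<times> ?B)"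
  proof (rule has_sum_finite_support_iff)
    show "?A \<times> ?B \<subseteq> A \<times> B"
      using sub by blast
    show "f p = 0" if "p \<in> A \<times> B - ?A \<times> ?B" for p
      using zero that by (cases p) blast
  qed (use finAB in blast)
  ultimately show ?thesis by blast
qed

lemma has_sum_cmult_finite_support:
  fixes f :: "'a \<Rightarrow> int"
  assumes "(f has_sum s) A" "finite {x \<in> A. f x \<noteq> 0}"
  shows "((\<lambda>x. c * f x) has_sum c * s) A"
proof -
  have "(f has_sum s) A \<longleftrightarrow> s = sum f {x \<in> A. f x \<noteq> 0}"
    by (rule has_sum_finite_support_iff[OF assms(2)]) auto
  then have "s = sum f {x \<in> A. f x \<noteq> 0}"
    using assms(1) by blast
  moreover have "((\<lambda>x. c * f x) has_sum c * s) A \<longleftrightarrow> c * s = (\<Sum>x\<in>{x \<in> A. f x \<noteq> 0}. c * f x)"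
    by (rule has_sum_finite_support_iff[OF assms(2)]) auto
  ultimately show ?thesis
    using sum_distrib_left by metis
qed

lemma has_sum_product:
  fixes f :: "'a \<Rightarrow> int" and g :: "'b \<Rightarrow> int"
  assumes f: "(f has_sum s) A" "finite {a \<in> A. f a \<noteq> 0}"
    and g: "(g has_sum t) B" "finite {b \<in> B. g b \<noteq> 0}"
  shows "((\<lambda>(a, b). f a * g b) has_sum s * t) (A \<times> B)"
proof (rule has_sum_iterated)
  show "finite {p \<in> A \<times> B. (case p of (a, b) \<Rightarrow> f a * g b) \<noteq> 0}"
    by (rule finite_subset[OF _ finite_cartesian_product[OF f(2) g(2)]]) auto
  show "((\<lambda>b. case (a, b) of (a, b) \<Rightarrow> f a * g b) has_sum f a * t) B" for a
    using has_sum_cmult_finite_support[OF g, of "f a"] by simp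
  show "((\<lambda>a. f a * t) has_sum s * t) A"
    using has_sum_cmult_finite_support[OF f, of t] by (simp add: mult.commute)
qed

section \<open>The nested binomial sum\<close>

text \<open>
  The convention that \<^const>\<open>binom\<close> vanishes outside \<open>0 \<le> M \<le> N\<close> is itself symmetric, so
  the symmetry holds for all integers.
\<close>

lemma binom_symmetric: "binom N (N - M) = binom N M"
proof (cases "0 \<le> M \<and> M \<le> N")
  case True
  then have "nat (N - M) = nat N - nat M" "nat M \<le> nat N"
    by auto
  with True binomial_symmetric[of "nat M" "nat N"] show ?thesis
    by (simp add: binom_def)
qed (auto simp: binom_def)

lemma binomial_theorem_has_sum:
  assumes "N \<ge> 0"
  shows "((\<lambda>x. binom N x * y ^ nat x) has_sum (y + 1) ^ nat N) UNIV"
proof -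
  have "(y + 1) ^ nat N = (\<Sum>k\<le>nat N. int (nat N choose k) * y ^ k)"
    by (simp add: binomial_ring)
  also have "\<dots> = (\<Sum>x\<in>{0..N}. binom N x * y ^ nat x)"
    by (rule sum.reindex_bij_witness[of _ nat int]) (use assms in \<open>auto simp: binom_def\<close>)
  finally have "(y + 1) ^ nat N = (\<Sum>x\<in>{0..N}. binom N x * y ^ nat x)" .
  then show ?thesis
    by (subst has_sum_finite_support_iff[of "{0..N}"]) (auto simp: binom_def)
qed

definition chain_weight :: "int \<Rightarrow> (int \<Rightarrow> int) \<Rightarrow> int \<Rightarrow> (int \<Rightarrow> int) \<Rightarrow> int"
  where "chain_weight K r N m =
    binom N (m K) * (\<Prod>i=1..K-1. binom (r i - r (i + 1) + m (i + 1)) (m i))"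

definition step_factor :: "int \<Rightarrow> (int \<Rightarrow> int) \<Rightarrow> int"
  where "step_factor K r = (\<Prod>i=1..K-1. (i + 1) ^ nat (r i - r (i + 1)))"

lemma finite_chain_support: "finite {m \<in> tuples {1..K}. chain_weight K r N m \<noteq> 0}"
  unfolding chain_weight_def by (rule finite_support_right)

lemma bij_betw_append_last:
  assumes "0 \<le> (K::int)"
  shows "bij_betw (\<lambda>(x, m). m(K + 1 := x)) (UNIV \<times> tuples {1..K}) (tuples {1..K+1})"
  by (rule bij_betw_byWitness[where f' = "\<lambda>m. (m (K + 1), m(K + 1 := 0))"])
    (use assms in \<open>auto simp: tuples_def fun_eq_iff\<close>)

lemma atLeastAtMost_extend: "1 \<le> (K::int) \<Longrightarrow> {1..K} = insert K {1..K-1}"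
  by auto

lemma chain_weight_append_last:
  assumes "1 \<le> K"
  shows "chain_weight (K + 1) r N (m(K + 1 := x)) =
    binom N x * chain_weight K r (r K - r (K + 1) + x) m"
proof -
  have "(\<Prod>i=1..K-1. binom (r i - r (i + 1) + (m(K + 1 := x)) (i + 1)) ((m(K + 1 := x)) i))
      = (\<Prod>i=1..K-1. binom (r i - r (i + 1) + m (i + 1)) (m i))"
    by (intro prod.cong) auto
  then show ?thesis
    by (simp add: chain_weight_def atLeastAtMost_extend[OF assms])
qed

text \<open>
  Induction on \<open>K\<close>, with \<open>N\<close> arbitrary. For a fixed last entry \<open>x\<close> the other entries form a
  shorter chain with top number \<open>r K - r (K + 1) + x\<close>. Its sum depends on \<open>x\<close> through the factor
  \<open>(K + 1) ^ x\<close> alone, and the binomial theorem sums this against \<open>binom N x\<close> to \<open>(K + 2) ^ N\<close>.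
\<close>

lemma chain_weight_has_sum:
  assumes "1 \<le> K" "\<And>i. 1 \<le> i \<Longrightarrow> i < K \<Longrightarrow> r (i + 1) \<le> r i" "0 \<le> N"
  shows "(chain_weight K r N has_sum step_factor K r * (K + 1) ^ nat N) (tuples {1..K})"
  using assms
proof (induction K arbitrary: N rule: int_ge_induct)
  case base
  have bij: "bij_betw (\<lambda>x. (\<lambda>_. 0)(1 := x)) (UNIV :: int set) (tuples {1..1} :: (int \<Rightarrow> int) set)"
    by (rule bij_betw_byWitness[where f' = "\<lambda>m. m 1"]) (auto simp: tuples_def fun_eq_iff)
  show ?case
    using binomial_theorem_has_sum[OF base(2), of 1]
    by (subst has_sum_reindex_bij_betw[OF bij, symmetric]) (simp add: chain_weight_def step_factor_def)
next
  case (step K)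
  let ?f = "\<lambda>(x, m). binom N x * chain_weight K r (r K - r (K + 1) + x) m"
  let ?S = "step_factor K r" and ?d = "r K - r (K + 1)"
  have d: "0 \<le> ?d"
    using step.prems(1)[of K] step.hyps by simp
  have factor: "step_factor (K + 1) r = ?S * (K + 1) ^ nat ?d"
    using step.hyps by (simp add: step_factor_def atLeastAtMost_extend)
  have bij: "bij_betw (\<lambda>(x, m). m(K + 1 := x)) (UNIV \<times> tuples {1..K}) (tuples {1..K+1})"
    using step.hyps by (intro bij_betw_append_last) simp
  have weight: "chain_weight (K + 1) r N (case p of (x, m) \<Rightarrow> m(K + 1 := x)) = ?f p" for p
    using step.hyps by (cases p) (simp add: chain_weight_append_last)
  have "(?f has_sum step_factor (K + 1) r * (K + 1 + 1) ^ nat N) (UNIV \<times> tuples {1..K})"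
  proof (rule has_sum_iterated)
    let ?U = "{p \<in> UNIV \<times> tuples {1..K}. ?f p \<noteq> 0}"
    have "(\<lambda>(x, m). m(K + 1 := x)) ` ?U \<subseteq> {m \<in> tuples {1..K+1}. chain_weight (K + 1) r N m \<noteq> 0}"
      using bij_betw_apply[OF bij] weight by fastforce
    then have "finite ((\<lambda>(x, m). m(K + 1 := x)) ` ?U)"
      using finite_chain_support finite_subset by blast
    then show "finite ?U"
      by (rule finite_imageD) (rule inj_on_subset[OF bij_betw_imp_inj_on[OF bij]], auto)
  next
    fix x :: int
    show "((\<lambda>m. ?f (x, m)) has_sum step_factor (K + 1) r * (binom N x * (K + 1) ^ nat x)) (tuples {1..K})"
      \<comment> \<open>For negative \<open>x\<close> the induction hypothesis may fail to apply, but \<open>binom N x\<close> vanishes.\<close>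
    proof (cases "0 \<le> x")
      case True
      have IH: "(chain_weight K r (?d + x) has_sum ?S * (K + 1) ^ nat (?d + x)) (tuples {1..K})"
        using step.prems(1) d True by (intro step.IH) auto
      have "nat (?d + x) = nat ?d + nat x"
        using d True by simp
      then have "binom N x * (?S * (K + 1) ^ nat (?d + x))
          = step_factor (K + 1) r * (binom N x * (K + 1) ^ nat x)"
        by (simp add: factor power_add)
      with has_sum_cmult_finite_support[OF IH finite_chain_support, of "binom N x"]
      show ?thesis by simp
    qed (simp add: binom_def)
  next
    have "finite {x \<in> UNIV. binom N x * (K + 1) ^ nat x \<noteq> 0}"
      by (rule finite_subset[of _ "{0..N}"]) (auto simp: binom_def)
    from has_sum_cmult_finite_support[OF binomial_theorem_has_sum[OF step.prems(2)] this]
    show "((\<lambda>x. step_factor (K + 1) r * (binom N x * (K + 1) ^ nat x))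
        has_sum step_factor (K + 1) r * (K + 1 + 1) ^ nat N) UNIV" .
  qed
  then show ?case
    by (subst has_sum_reindex_bij_betw[OF bij, symmetric]) (simp add: weight)
qed

section \<open>Splitting the gaps into two rows\<close>

text \<open>
  The parameters \<open>p\<close> and \<open>q\<close> are \<open>1\<close> and \<open>2\<close> in either order, so that the residues of \<open>b\<close>
  modulo \<open>3\<close> are treated together: \<open>-q\<close> is the class of \<open>b\<close> and \<open>-p\<close> the class of \<open>2b\<close>.
\<close>

definition two_rows :: "int \<Rightarrow> int \<Rightarrow> int \<Rightarrow> int \<Rightarrow> int set"
  where "two_rows p q K L = (\<lambda>j. 3 * j - p) ` {1..K+L} \<union> (\<lambda>j. 3 * j - q) ` {1..K}"

definition row_tuples :: "int \<Rightarrow> int \<Rightarrow> int \<Rightarrow> int \<Rightarrow> (int \<Rightarrow> int) \<Rightarrow> (int \<Rightarrow> int) set"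
  where "row_tuples p q K L r =
    {n \<in> tuples (two_rows p q K L). \<forall>j\<in>{1..L}. n (3 * (K + L + 1 - j) - p) = r j}"

definition row_weight :: "int \<Rightarrow> int \<Rightarrow> int \<Rightarrow> (int \<Rightarrow> int) \<Rightarrow> (int \<Rightarrow> int) \<Rightarrow> int"
  where "row_weight p q K r n =
    (\<Prod>j=1..K. binom (n (3 * (j + 1) - p)) (n (3 * j - p))) *
    (\<Prod>j=1..K. binom (r (K + 1 - j) - n (3 * (j - 1) - q)) (n (3 * j - q) - n (3 * (j - 1) - q)))"

text \<open>
  The second component reads the short row backwards and complements it: this is the
  substitution that turns the weight of the short row into a \<^const>\<open>chain_weight\<close>.
\<close>

definition separate_rows :: "int \<Rightarrow> int \<Rightarrow> int \<Rightarrow> (int \<Rightarrow> int) \<Rightarrow> (int \<Rightarrow> int) \<Rightarrow> (int \<Rightarrow> int) \<times> (int \<Rightarrow> int)"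
  where "separate_rows p q K r n =
    (\<lambda>j. if j \<in> {1..K} then n (3 * j - p) else 0,
     \<lambda>i. if i \<in> {1..K} then r i - n (3 * (K + 1 - i) - q) else 0)"

definition merge_rows ::
  "int \<Rightarrow> int \<Rightarrow> int \<Rightarrow> int \<Rightarrow> (int \<Rightarrow> int) \<Rightarrow> (int \<Rightarrow> int) \<times> (int \<Rightarrow> int) \<Rightarrow> int \<Rightarrow> int"
  where "merge_rows p q K L r = (\<lambda>(a, d) x.
    if x \<notin> two_rows p q K L then 0
    else if 3 dvd x + p then
      let j = (x + p) div 3 in if j \<le> K then a j else r (K + L + 1 - j)
    else let j = (x + q) div 3 in r (K + 1 - j) - d (K + 1 - j))"

text \<open>
  The smallest elements of the semigroup in the classes \<open>-q\<close> and \<open>-p\<close> are \<open>b = 3 (K + 1) - q\<close> and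
  \<open>2b = 3 (K + L + 1) - p\<close>; the rows stop one step before them.
\<close>

lemma gaps_eq_two_rows:
  assumes pq: "p = 1 \<and> q = 2 \<or> p = 2 \<and> q = 1" and K: "0 \<le> K"
    and b: "b = 3 * (K + 1) - q" and b2: "2 * b = 3 * (K + L + 1) - p"
  shows "gaps b = two_rows p q K L"
proof
  show "gaps b \<subseteq> two_rows p q K L"
  proof
    fix i assume i: "i \<in> gaps b"
    from pq show "i \<in> two_rows p q K L"
    proof
      assume pq: "p = 1 \<and> q = 2"
      then have "L = K" "b = 3 * K + 1" using b b2 by auto
      with gaps_1[OF \<open>b = 3 * K + 1\<close> i] pq show ?thesis
        by (auto simp: two_rows_def)
    next
      assume pq: "p = 2 \<and> q = 1"
      then have "L = K + 1" "b = 3 * (K + 1) - 1" using b b2 by auto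
      with gaps_2[OF \<open>b = 3 * (K + 1) - 1\<close> i] pq show ?thesis
        by (auto simp: two_rows_def)
    qed
  qed
next
  have b0: "0 \<le> b" using b K pq by auto
  show "two_rows p q K L \<subseteq> gaps b"
  proof
    fix i assume "i \<in> two_rows p q K L"
    then consider (long) j where "i = 3 * j - p" "1 \<le> j" "j \<le> K + L"
      | (short) j where "i = 3 * j - q" "1 \<le> j" "j \<le> K"
      by (auto simp: two_rows_def)
    then show "i \<in> gaps b"
    proof cases
      case long
      have False if x: "0 \<le> x" and y: "0 \<le> y" and eq: "i = 3 * x + b * y" for x y
      proof -
        consider "y = 0" | "y = 1" | "2 \<le> y" using y by linarith
        then show False
        proof cases
          case 1
          then have "3 * j - p = 3 * x" using eq long by simp
          then show False using pq by presburger
        next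
          case 2
          then have "3 * j - p = 3 * x + 3 * (K + 1) - q" using eq long b by simp
          then show False using pq by presburger
        next
          case 3
          then have "b * 2 \<le> b * y" using b0 mult_left_mono by blast
          then show False using eq x long b2 by simp
        qed
      qed
      then show ?thesis using long pq by (auto simp: gaps_def Gam_def)
    next
      case short
      have False if x: "0 \<le> x" and y: "0 \<le> y" and eq: "i = 3 * x + b * y" for x y
      proof (cases "y = 0")
        case True
        then have "3 * j - q = 3 * x" using eq short by simp
        then show False using pq by presburger
      next
        case False
        then have "b * 1 \<le> b * y" using b0 y by (intro mult_left_mono) auto
        then show False using eq x short b by simp
      qed
      then show ?thesis using short pq by (auto simp: gaps_def Gam_def)
    qed
  qed
qed

lemma bij_betw_separate_rows:
  assumes pq: "p = 1 \<and> q = 2 \<or> p = 2 \<and> q = 1" and L: "0 \<le> K" "0 \<le> L"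
  shows "bij_betw (separate_rows p q K r) (row_tuples p q K L r) (tuples {1..K} \<times> tuples {1..K})"
proof (rule bij_betw_byWitness[where f' = "merge_rows p q K L r"])
  have long: "3 * j - p \<in> two_rows p q K L" if "1 \<le> j" "j \<le> K + L" for j
    using that by (auto simp: two_rows_def)
  have short: "3 * j - q \<in> two_rows p q K L" if "1 \<le> j" "j \<le> K" for j
    using that by (auto simp: two_rows_def)
  have other: "\<not> 3 dvd 3 * j - q + p" for j
    using pq by presburger
  have m_long: "merge_rows p q K L r (a, d) (3 * j - p) = (if j \<le> K then a j else r (K + L + 1 - j))"
    if "1 \<le> j" "j \<le> K + L" for a d j
    using long[OF that] by (simp add: merge_rows_def)
  have m_short: "merge_rows p q K L r (a, d) (3 * j - q) = r (K + 1 - j) - d (K + 1 - j)"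
    if "1 \<le> j" "j \<le> K" for a d j
    using short[OF that] other by (simp add: merge_rows_def)
  have m_out: "merge_rows p q K L r (a, d) x = 0" if "x \<notin> two_rows p q K L" for a d x
    using that by (simp add: merge_rows_def)
  show "\<forall>n\<in>row_tuples p q K L r. merge_rows p q K L r (separate_rows p q K r n) = n"
  proof (intro ballI ext)
    fix n x assume n: "n \<in> row_tuples p q K L r"
    obtain a d where ad: "separate_rows p q K r n = (a, d)" by fastforce
    then have a: "a = (\<lambda>j. if j \<in> {1..K} then n (3 * j - p) else 0)"
      and d: "d = (\<lambda>i. if i \<in> {1..K} then r i - n (3 * (K + 1 - i) - q) else 0)"
      by (simp_all add: separate_rows_def)
    show "merge_rows p q K L r (separate_rows p q K r n) x = n x"
    proof (cases "x \<in> two_rows p q K L")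
      case True
      then consider (l) j where "x = 3 * j - p" "1 \<le> j" "j \<le> K + L"
        | (s) j where "x = 3 * j - q" "1 \<le> j" "j \<le> K"
        by (auto simp: two_rows_def)
      then show ?thesis
      proof cases
        case l
        have "r (K + L + 1 - j) = n (3 * j - p)" if "K < j"
        proof -
          have "K + L + 1 - j \<in> {1..L}" using l that by simp
          then have "n (3 * (K + L + 1 - (K + L + 1 - j)) - p) = r (K + L + 1 - j)"
            using n by (auto simp only: row_tuples_def)
          then show ?thesis by simp
        qed
        then show ?thesis using l by (simp add: ad m_long) (simp add: a)
      next
        case s
        then show ?thesis by (simp add: ad m_short) (simp add: d)
      qed
    next
      case False
      then show ?thesis using n by (simp add: ad m_out row_tuples_def tuples_def)
    qed
  qed
  show "\<forall>ad\<in>tuples {1..K} \<times> tuples {1..K}. separate_rows p q K r (merge_rows p q K L r ad) = ad"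
  proof (clarify)
    fix a d assume ad: "a \<in> tuples {1..K}" "d \<in> tuples {1..K}"
    show "separate_rows p q K r (merge_rows p q K L r (a, d)) = (a, d)"
    proof -
      have "(if j \<in> {1..K} then merge_rows p q K L r (a, d) (3 * j - p) else 0) = a j" for j
        using ad(1) L by (auto simp: m_long tuples_def)
      moreover have "(if i \<in> {1..K} then r i - merge_rows p q K L r (a, d) (3 * (K + 1 - i) - q) else 0)
          = d i" for i
        using ad(2) m_short[of "K + 1 - i" a d] by (auto simp: tuples_def)
      ultimately show ?thesis
        by (simp add: separate_rows_def)
    qed
  qed
  show "separate_rows p q K r ` row_tuples p q K L r \<subseteq> tuples {1..K} \<times> tuples {1..K}"
    by (auto simp: separate_rows_def tuples_def)
  show "merge_rows p q K L r ` (tuples {1..K} \<times> tuples {1..K}) \<subseteq> row_tuples p q K L r"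
  proof -
    have "merge_rows p q K L r (a, d) (3 * (K + L + 1 - j) - p) = r j" if "j \<in> {1..L}" for a d j
      using m_long[of "K + L + 1 - j" a d] that L by simp
    \<comment> \<open>The index must keep the form \<open>3 * (K + L + 1 - j) - p\<close> for this equation to rewrite.\<close>
    then show ?thesis
      by (auto simp: row_tuples_def tuples_def m_out simp del: right_diff_distrib_numeral)
  qed
qed

text \<open>
  The long row needs no change of variables: its entry after the last free one is \<open>r L\<close>. For the
  short row put \<open>M = r i - n (3 * (K - i) - q)\<close>, the top number of the factor \<open>j = K + 1 - i\<close>. The
  bottom number is \<open>M - d i\<close> by definition of \<open>d\<close>, and \<open>M = r i - r (i + 1) + d (i + 1)\<close>.
\<close>

lemma row_weight_eq_chain_weights:
  assumes pq: "p = 1 \<and> q = 2 \<or> p = 2 \<and> q = 1" and KL: "1 \<le> K" "1 \<le> L"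
    and n: "n \<in> row_tuples p q K L r"
  shows "row_weight p q K r n = (case separate_rows p q K r n of (a, d) \<Rightarrow>
    chain_weight K (\<lambda>_. 0) (r L) a * chain_weight K r (r K) d)"
proof -
  let ?a = "fst (separate_rows p q K r n)" and ?d = "snd (separate_rows p q K r n)"
  have a: "?a j = n (3 * j - p)" if "1 \<le> j" "j \<le> K" for j
    using that by (simp add: separate_rows_def)
  have d: "?d i = r i - n (3 * (K + 1 - i) - q)" if "1 \<le> i" "i \<le> K" for i
    using that by (simp add: separate_rows_def)
  have rL: "n (3 * (K + 1) - p) = r L"
    using n KL(2) by (auto simp: row_tuples_def dest!: bspec[of _ _ L])
  \<comment> \<open>The entry before the short row is zero, so its first factor has top number \<open>r K\<close>.\<close>
  have "- q \<notin> two_rows p q K L"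
  proof
    assume "- q \<in> two_rows p q K L"
    then obtain j where "1 \<le> j" "- q = 3 * j - p \<or> - q = 3 * j - q"
      by (auto simp: two_rows_def)
    then show False
      using pq by presburger
  qed
  then have n0: "n (- q) = 0"
    using n by (simp add: row_tuples_def tuples_def)
  have "(\<Prod>j=1..K-1. binom (n (3 * (j + 1) - p)) (n (3 * j - p)))
      = (\<Prod>i=1..K-1. binom (0 - 0 + ?a (i + 1)) (?a i))"
    by (intro prod.cong) (auto simp: a)
  then have 1: "(\<Prod>j=1..K. binom (n (3 * (j + 1) - p)) (n (3 * j - p)))
      = chain_weight K (\<lambda>_. 0) (r L) ?a"
    using KL(1) rL by (simp add: chain_weight_def atLeastAtMost_extend a)
  let ?g = "\<lambda>i. binom (r i - n (3 * (K - i) - q)) (n (3 * (K + 1 - i) - q) - n (3 * (K - i) - q))"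
  have "(\<Prod>j=1..K. binom (r (K + 1 - j) - n (3 * (j - 1) - q)) (n (3 * j - q) - n (3 * (j - 1) - q)))
      = prod ?g {1..K}"
    by (rule prod.reindex_bij_witness[of _ "\<lambda>i. K + 1 - i" "\<lambda>j. K + 1 - j"]) auto
  also have "\<dots> = ?g K * prod ?g {1..K-1}"
    using KL(1) by (simp add: atLeastAtMost_extend)
  also have "?g K = binom (r K) (?d K)"
    using KL(1) by (simp add: d n0 binom_symmetric)
  also have "prod ?g {1..K-1} = (\<Prod>i=1..K-1. binom (r i - r (i + 1) + ?d (i + 1)) (?d i))"
  proof (rule prod.cong)
    fix i assume "i \<in> {1..K-1}"
    then have i: "?d (i + 1) = r (i + 1) - n (3 * (K - i) - q)"
      "?d i = r i - n (3 * (K + 1 - i) - q)"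
      using d[of i] d[of "i + 1"] by auto
    show "?g i = binom (r i - r (i + 1) + ?d (i + 1)) (?d i)"
      unfolding i by (subst binom_symmetric[symmetric]) simp
  qed simp
  finally have 2: "(\<Prod>j=1..K. binom (r (K + 1 - j) - n (3 * (j - 1) - q))
      (n (3 * j - q) - n (3 * (j - 1) - q))) = chain_weight K r (r K) ?d"
    by (simp add: chain_weight_def)
  show ?thesis
    unfolding row_weight_def 1 2 by (simp add: case_prod_beta)
qed

section \<open>The identity\<close>

text \<open>
  Both sides equal \<open>step_factor K r * (K + 1) ^ (r K + r L)\<close>. On the left the long row contributes
  \<open>(K + 1) ^ r L\<close>, because the step factor of a constant sequence is \<open>1\<close>.
\<close>

lemma row_sum_eq_chain_sum:
  assumes pq: "p = 1 \<and> q = 2 \<or> p = 2 \<and> q = 1" and KL: "1 \<le> K" "K \<le> L"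
    and r: "\<And>j. 1 \<le> j \<Longrightarrow> j < L \<Longrightarrow> r (j + 1) \<le> r j" "0 \<le> r L"
  shows "(\<Sum>\<^sub>\<infinity>n\<in>row_tuples p q K L r. row_weight p q K r n)
    = (\<Sum>\<^sub>\<infinity>m\<in>tuples {1..K}. chain_weight K r (r K + r L) m)"
proof -
  have rK: "0 \<le> r K"
    using antimono_seq[of L r K L, OF r(1)] KL r(2) by simp
  have rd: "r (i + 1) \<le> r i" if "1 \<le> i" "i < K" for i
    using r(1) KL that by simp
  let ?w = "\<lambda>(a, d). chain_weight K (\<lambda>_. 0) (r L) a * chain_weight K r (r K) d"
  have "(?w has_sum (K + 1) ^ nat (r L) * (step_factor K r * (K + 1) ^ nat (r K)))
      (tuples {1..K} \<times> tuples {1..K})"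
    using chain_weight_has_sum[of K "\<lambda>_. 0" "r L"] chain_weight_has_sum[of K r "r K"] KL(1) r(2) rd rK
    by (intro has_sum_product finite_chain_support) (auto simp: step_factor_def)
  then have "((\<lambda>n. ?w (separate_rows p q K r n)) has_sum
      (K + 1) ^ nat (r L) * (step_factor K r * (K + 1) ^ nat (r K))) (row_tuples p q K L r)"
    using KL by (subst has_sum_reindex_bij_betw[OF bij_betw_separate_rows[OF pq]]) auto
  moreover have "row_weight p q K r n = ?w (separate_rows p q K r n)"
    if "n \<in> row_tuples p q K L r" for n
    using row_weight_eq_chain_weights[OF pq KL(1) _ that] KL by simp
  ultimately have "(row_weight p q K r has_sum
      (K + 1) ^ nat (r L) * (step_factor K r * (K + 1) ^ nat (r K))) (row_tuples p q K L r)"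
    by (simp cong: has_sum_cong)
  moreover have "(chain_weight K r (r K + r L) has_sum step_factor K r * (K + 1) ^ nat (r K + r L))
      (tuples {1..K})"
    by (intro chain_weight_has_sum KL(1) rd) (use rK r(2) in auto)
  moreover have "nat (r K + r L) = nat (r K) + nat (r L)"
    using rK r(2) by simp
  ultimately show ?thesis
    by (simp add: infsumI power_add mult_ac)
qed

theorem theorem7:
  fixes b f k :: int and r :: "int \<Rightarrow> int"
  assumes "b > 3" and "coprime b 3"
    and "f = 2 * b - 3"
    and k_closest: "\<And>z::int. z \<noteq> k \<Longrightarrow>
      \<bar>real_of_int k - real_of_int b / 3\<bar> < \<bar>real_of_int z - real_of_int b / 3\<bar>"
    and r_decreasing: "\<And>j. 1 \<le> j \<Longrightarrow> j < k \<Longrightarrow> r (j + 1) \<le> r j"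
    and "r k \<ge> 0"
  shows
    "(b = 3 * k + 1 \<longrightarrow>
        (\<Sum>\<^sub>\<infinity>n\<in>{n \<in> tuples (gaps b). \<forall>j\<in>{1..k}. n (f + 3 - 3 * j) = r j}.
           (\<Prod>j=1..k. binom (n (3 * j + 2)) (n (3 * j - 1))) *
           (\<Prod>j=1..k. binom (r (k - j + 1) - n (3 * j - 5)) (n (3 * j - 2) - n (3 * j - 5))))
      = (\<Sum>\<^sub>\<infinity>m\<in>tuples {1..k}.
           binom (2 * r k) (m k) *
           (\<Prod>i=1..k-1. binom (r i - r (i + 1) + m (i + 1)) (m i))))
   \<and> (b = 3 * k - 1 \<longrightarrow>
        (\<Sum>\<^sub>\<infinity>n\<in>{n \<in> tuples (gaps b). \<forall>j\<in>{1..k}. n (f + 3 - 3 * j) = r j}.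
           (\<Prod>j=1..k-1. binom (n (3 * j + 1)) (n (3 * j - 2))) *
           (\<Prod>j=1..k-1. binom (r (k - j) - n (3 * j - 4)) (n (3 * j - 1) - n (3 * j - 4))))
      = (\<Sum>\<^sub>\<infinity>m\<in>tuples {1..k-1}.
           binom (r (k - 1) + r k) (m (k - 1)) *
           (\<Prod>i=1..k-2. binom (r i - r (i + 1) + m (i + 1)) (m i))))"
proof (intro conjI impI)
  assume b: "b = 3 * k + 1"
  have gaps: "gaps b = two_rows 1 2 k k"
    using assms(1) b by (intro gaps_eq_two_rows) auto
  have index: "f + 3 - 3 * j = 3 * (k + k + 1 - j) - 1" for j
    using assms(3) b by simp
  have "(\<Sum>\<^sub>\<infinity>n\<in>row_tuples 1 2 k k r. row_weight 1 2 k r n)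
      = (\<Sum>\<^sub>\<infinity>m\<in>tuples {1..k}. chain_weight k r (r k + r k) m)"
    using assms(1,6) b r_decreasing by (intro row_sum_eq_chain_sum) auto
  then show "(\<Sum>\<^sub>\<infinity>n\<in>{n \<in> tuples (gaps b). \<forall>j\<in>{1..k}. n (f + 3 - 3 * j) = r j}.
           (\<Prod>j=1..k. binom (n (3 * j + 2)) (n (3 * j - 1))) *
           (\<Prod>j=1..k. binom (r (k - j + 1) - n (3 * j - 5)) (n (3 * j - 2) - n (3 * j - 5))))
      = (\<Sum>\<^sub>\<infinity>m\<in>tuples {1..k}.
           binom (2 * r k) (m k) *
           (\<Prod>i=1..k-1. binom (r i - r (i + 1) + m (i + 1)) (m i)))"
    unfolding index gaps row_tuples_def row_weight_def chain_weight_def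
    by (simp add: algebra_simps)
next
  assume b: "b = 3 * k - 1"
  have gaps: "gaps b = two_rows 2 1 (k - 1) k"
    using assms(1) b by (intro gaps_eq_two_rows) auto
  have index: "f + 3 - 3 * j = 3 * ((k - 1) + k + 1 - j) - 2" for j
    using assms(3) b by simp
  have "(\<Sum>\<^sub>\<infinity>n\<in>row_tuples 2 1 (k - 1) k r. row_weight 2 1 (k - 1) r n)
      = (\<Sum>\<^sub>\<infinity>m\<in>tuples {1..k-1}. chain_weight (k - 1) r (r (k - 1) + r k) m)"
    using assms(1,6) b r_decreasing by (intro row_sum_eq_chain_sum) auto
  then show "(\<Sum>\<^sub>\<infinity>n\<in>{n \<in> tuples (gaps b). \<forall>j\<in>{1..k}. n (f + 3 - 3 * j) = r j}.
           (\<Prod>j=1..k-1. binom (n (3 * j + 1)) (n (3 * j - 2))) *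
           (\<Prod>j=1..k-1. binom (r (k - j) - n (3 * j - 4)) (n (3 * j - 1) - n (3 * j - 4))))
      = (\<Sum>\<^sub>\<infinity>m\<in>tuples {1..k-1}.
           binom (r (k - 1) + r k) (m (k - 1)) *
           (\<Prod>i=1..k-2. binom (r i - r (i + 1) + m (i + 1)) (m i)))"
    unfolding index gaps row_tuples_def row_weight_def chain_weight_def
    by (simp add: algebra_simps)
qed

end
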